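(* Let $1\le n\le p$ be integers, let $X\in\mathbb{R}^{n\times p}$ be a matrix of full rank $n$, let $\beta^\star\in\mathbb{R}^p$, $\varepsilon\in\mathbb{R}^n$, $y=X\beta^\star+\varepsilon$, and let $\lambda_n^0\in\mathbb{R}$ be such that $\|X^\top\varepsilon\|_{\ell_\infty}\le\lambda_n^0$. (i) Assume that $X$ satisfies $\mathrm{UDP}(S_0,\kappa_0,\Delta)$, where $1\le S_0\le p$ and $0<\kappa_0<1/2$. Let $\lambda_\ell>0$ satisfy $\lambda_\ell>\lambda_n^0/(1-2\kappa_0)$, and let $\beta^\ell$ be a lasso estimator with parameter $\lambda_\ell$. Then $$\|X\beta^\ell-X\beta^\star\|_{\ell_2}\le\min_{\mathcal S}\Bigg[4\lambda_\ell\,\Delta\sqrt s+\frac{\|\beta^\star_{\mathcal S^c}\|_{\ell_1}}{\Delta\sqrt s}\Bigg],$$ where the minimum is over all $\mathcal S\subseteq\{1,\dots,p\}$ with $|\mathcal S|=s$, $1\le s\le S_0$. (ii) Let $\rho_n>0$ be the smallest singular value of $X$ and $\delta$ the distortion of $\ker(X)$ (with no UDP assumption). For all $0<\kappa_0<1/2$, all $\lambda_\ell>0$ with $\lambda_\ell>\lambda_n^0/(1-2\kappa_0)$, every lasso estimator $\beta^\ell$ with parameter $\lambda_\ell$, and every $\mathcal S\subseteq\{1,\dots,p\}$ with $|\mathcal S|=s$, $1\le s\le(\kappa_0/\delta)^2p$, $$\|X\beta^\ell-X\beta^\star\|_{\ell_2}\le 4\lambda_\ell\cdot\frac{2\,\delta}{\rho_n}\cdot\sqrt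 s+\frac{1}{2\delta\sqrt s}\cdot\rho_n\,\|\beta^\star_{\mathcal S^c}\|_{\ell_1}$$ (i.e. the bound holds with the minimum over all such $\mathcal S$ on the right-hand side).
   Context: For $x\in\mathbb{R}^m$, $\|x\|_{\ell_1}=\sum_i|x_i|$, $\|x\|_{\ell_2}=(\sum_i x_i^2)^{1/2}$, $\|x\|_{\ell_\infty}=\max_i|x_i|$. For $\gamma\in\mathbb{R}^p$ and $\mathcal S\subseteq\{1,\dots,p\}$, $\gamma_{\mathcal S}\in\mathbb{R}^p$ is the vector with $(\gamma_{\mathcal S})_i=\gamma_i$ if $i\in\mathcal S$ and $0$ otherwise; $\mathcal S^c=\{1,\dots,p\}\setminus\mathcal S$. The singular values of the rank-$n$ matrix $X$ ($n\le p$) are $\rho_1\ge\dots\ge\rho_n>0$. Lasso estimator with parameter $\lambda_\ell>0$: any $$\beta^\ell\in\arg\min_{\beta\in\mathbb{R}^p}\Big\{\tfrac12\|X\beta-y\|_{\ell_2}^2+\lambda_\ell\|\beta\|_{\ell_1}\Big\}.$$ Universal Distortion Property: for $1\le S_0\le p$, $0<\kappa_0<1/2$ and $\Delta>0$, $X$ satisfies $\mathrm{UDP}(S_0,\kappa_0,\Delta)$ if for all $\gamma\in\mathbb{R}^p$, all integers $s$ with $1\le s\le S_0$, and all $\mathcal S\subseteq\{1,\dots,p\}$ with $|\mathcal S|=s$, $$\|\gamma_{\mathcal S}\|_{\ell_1}\le\Delta\sqrt s\,\|X\gamma\|_{\ell_2}+\kappa_0\|\gamma\|_{\ell_1}.$$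 A subspace $\Gamma\subset\mathbb{R}^p$ has distortion $\delta$, with $1\le\delta\le\sqrt p$, if $\|x\|_{\ell_1}\le\sqrt p\,\|x\|_{\ell_2}\le\delta\,\|x\|_{\ell_1}$ for all $x\in\Gamma$. "The distortion" of $\Gamma$ is the smallest such $\delta$, i.e. $\delta=\sup_{x\in\Gamma\setminus\{0\}}\sqrt p\,\|x\|_{\ell_2}/\|x\|_{\ell_1}$ (and $\delta=1$ if $\Gamma=\{0\}$). *)

theory Defs
  imports "HOL-Analysis.Analysis"
begin

text \<open>
  Vectors of dimension \<open>p\<close> are elements of \<^typ>\<open>real ^ 'p\<close> with \<open>p = CARD('p)\<close>.
  The Euclidean norm is \<^const>\<open>norm\<close> and the maximum norm is \<^const>\<open>infnorm\<close>.
\<close>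

definition l1_norm :: "real ^ 'm \<Rightarrow> real" where
  "l1_norm x = (\<Sum>i\<in>UNIV. \<bar>x $ i\<bar>)"

definition restrict_vec :: "'m set \<Rightarrow> real ^ 'm \<Rightarrow> real ^ 'm" where
  "restrict_vec S x = (\<chi> i. if i \<in> S then x $ i else 0)"

definition lasso_estimator :: "real ^ 'p ^ 'n \<Rightarrow> real ^ 'n \<Rightarrow> real \<Rightarrow> real ^ 'p \<Rightarrow> bool" where
  "lasso_estimator X y l \<beta> \<longleftrightarrow>
     is_arg_min (\<lambda>b. 1 / 2 * (norm (X *v b - y))\<^sup>2 + l * l1_norm b) (\<lambda>_. True) \<beta>"

text \<open>
  The Universal Distortion Property. The sparsity bound \<open>S0\<close> is real, so that it need
  not be an integer; only the integers \<open>s\<close> below it matter.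
\<close>

definition UDP :: "real ^ 'p ^ 'n \<Rightarrow> real \<Rightarrow> real \<Rightarrow> real \<Rightarrow> bool" where
  "UDP X S0 \<kappa> \<Delta> \<longleftrightarrow>
     (\<forall>\<gamma> (s::nat) S. 1 \<le> s \<and> real s \<le> S0 \<and> card S = s \<longrightarrow>
        l1_norm (restrict_vec S \<gamma>) \<le> \<Delta> * sqrt (real s) * norm (X *v \<gamma>) + \<kappa> * l1_norm \<gamma>)"

definition has_distortion :: "(real ^ 'p) set \<Rightarrow> real \<Rightarrow> bool" where
  "has_distortion \<Gamma> \<delta> \<longleftrightarrow> 1 \<le> \<delta> \<and> \<delta> \<le> sqrt (real CARD('p)) \<and>
     (\<forall>x\<in>\<Gamma>. l1_norm x \<le> sqrt (real CARD('p)) * norm x \<and>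
             sqrt (real CARD('p)) * norm x \<le> \<delta> * l1_norm x)"

definition distortion :: "(real ^ 'p) set \<Rightarrow> real" where
  "distortion \<Gamma> = (LEAST \<delta>. has_distortion \<Gamma> \<delta>)"

definition matrix_kernel :: "real ^ 'p ^ 'n \<Rightarrow> (real ^ 'p) set" where
  "matrix_kernel X = {x. X *v x = 0}"

text \<open>
  Singular values are described through pairs of unit singular vectors. Requiring both
  equations gives, for every shape of the matrix, exactly the values on the diagonal of a
  singular value decomposition; in particular \<open>0\<close> is one of them precisely when the
  rank is smaller than both dimensions.
\<close>

definition singular_values :: "real ^ 'p ^ 'n \<Rightarrow> real set" where
  "singular_values X = {\<sigma>. 0 \<le> \<sigma> \<and>
     (\<exists>u v. norm u = 1 \<and> norm v = 1 \<and> X *v v = \<sigma> *\<^sub>R u \<and> transpose X *v u = \<sigma> *\<^sub>R v)}"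

definition smallest_singular_value :: "real ^ 'p ^ 'n \<Rightarrow> real" where
  "smallest_singular_value X = Min (singular_values X)"


text \<open>The least distortion constant exists, so that \<^const>\<open>distortion\<close> is well defined.\<close>

lemma l1_norm_le: "l1_norm (x :: real ^ 'p) \<le> sqrt (real CARD('p)) * norm x"
  using L2_set_mult_ineq[of "\<lambda>_. 1" "\<lambda>i. x $ i" UNIV]
  by (simp add: l1_norm_def norm_vec_def L2_set_def)

lemma norm_le_l1_norm: "norm (x :: real ^ 'p) \<le> l1_norm x"
  unfolding l1_norm_def by (rule norm_le_l1_cart)

lemma is_least_distortion:
  fixes \<Gamma> :: "(real ^ 'p) set"
  shows "has_distortion \<Gamma> (distortion \<Gamma>)" and "has_distortion \<Gamma> \<delta> \<Longrightarrow> distortion \<Gamma> \<le> \<delta>"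
proof -
  let ?D = "{\<delta>. has_distortion \<Gamma> \<delta>}"
  have p: "1 \<le> sqrt (real CARD('p))"
    by (simp add: Suc_leI)
  have "has_distortion \<Gamma> (sqrt (real CARD('p)))"
    unfolding has_distortion_def using p by (auto intro!: l1_norm_le norm_le_l1_norm)
  then have ne: "?D \<noteq> {}" by blast
  have bdd: "bdd_below ?D"
    by (rule bdd_belowI[of _ 1]) (simp add: has_distortion_def)
  have eq: "?D = {1..sqrt (real CARD('p))} \<inter>
      (\<Inter>x\<in>\<Gamma>. {\<delta>. sqrt (real CARD('p)) * norm x \<le> \<delta> * l1_norm x})"
    by (auto simp: has_distortion_def l1_norm_le)
  have "closed ?D"
    unfolding eq by (intro closed_Int closed_INT closed_atLeastAtMost ballI closed_Collect_le
        continuous_intros)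
  with ne bdd have "Inf ?D \<in> ?D"
    by (intro closed_contains_Inf) auto
  moreover have "Inf ?D \<le> \<delta>" if "has_distortion \<Gamma> \<delta>" for \<delta>
    using that bdd by (intro cInf_lower) auto
  ultimately have "distortion \<Gamma> = Inf ?D"
    unfolding distortion_def by (intro Least_equality) auto
  with \<open>Inf ?D \<in> ?D\<close> \<open>\<And>\<delta>. has_distortion \<Gamma> \<delta> \<Longrightarrow> Inf ?D \<le> \<delta>\<close>
  show "has_distortion \<Gamma> (distortion \<Gamma>)" "has_distortion \<Gamma> \<delta> \<Longrightarrow> distortion \<Gamma> \<le> \<delta>"
    by auto
qed

end

theory Submission
  imports Defs
begin

text \<open>
  Put \<open>h = \<beta>l - \<beta>s\<close> and \<open>N = norm (X *v h)\<close>. Comparing the lasso objective at its minimiser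
  \<open>\<beta>l\<close> with its value at \<open>\<beta>s\<close>, and bounding the noise term by duality of the maximum norm and
  the \<open>\<ell>\<^sub>1\<close> norm, gives
  \<open>N\<^sup>2 / 2 \<le> l0 * l1_norm h + l * (2 * l1_norm (h on S) - l1_norm h + 2 * l1_norm (\<beta>s off S))\<close>.
  A distortion inequality \<open>l1_norm (h on S) \<le> a * N + \<kappa> * l1_norm h\<close> then leaves \<open>l1_norm h\<close> with
  the coefficient \<open>l0 - (1 - 2 * \<kappa>) * l\<close>, which is negative, so that
  \<open>N\<^sup>2 \<le> 4 * l * a * N + 4 * l * l1_norm (\<beta>s off S)\<close>. Solving this quadratic inequality gives
  \<open>N \<le> 4 * l * a + l1_norm (\<beta>s off S) / a\<close> (lemma \<open>lasso_prediction_error\<close>). The first claim is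
  the case \<open>a = \<Delta> * sqrt (card S)\<close>.

  For the second claim it remains to prove the distortion inequality with \<open>\<Delta> = 2 * \<delta> / \<rho>\<close>
  (lemma \<open>distortion_imp_UDP\<close>). Since \<open>X\<close> has full row rank, every \<open>\<gamma>\<close> splits as \<open>k + r\<close> where
  \<open>k\<close> lies in the kernel and \<open>r\<close> in the row space, and \<open>\<rho> * norm r \<le> norm (X *v \<gamma>)\<close>. On
  \<open>k\<close> the distortion makes the Euclidean norm small compared to the \<open>\<ell>\<^sub>1\<close> norm, which yields the
  \<open>\<kappa>\<close>-term, while everything involving \<open>r\<close> goes into the \<open>\<Delta>\<close>-term.
  The bound on \<open>r\<close> needs the variational description of \<open>\<rho>\<close> as the minimum of
  \<open>norm (transpose X *v u)\<close> over the unit sphere: a minimiser is a left singular vector because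
  the gradient of the Rayleigh quotient vanishes there.
\<close>

section \<open>The \<open>\<ell>\<^sub>1\<close> norm\<close>

lemma l1_norm_nonneg: "0 \<le> l1_norm x"
  by (simp add: l1_norm_def sum_nonneg)

lemma l1_norm_triangle: "l1_norm (x + y) \<le> l1_norm x + l1_norm y"
  unfolding l1_norm_def sum.distrib[symmetric] by (intro sum_mono) simp

lemma l1_norm_diff_triangle: "l1_norm (x - y) \<le> l1_norm x + l1_norm y"
  unfolding l1_norm_def sum.distrib[symmetric] by (intro sum_mono) simp

lemma restrict_vec_add: "restrict_vec S (x + y) = restrict_vec S x + restrict_vec S y"
  by (simp add: restrict_vec_def vec_eq_iff)

text \<open>
  The restricted vector has only \<open>card S\<close> entries, which replaces the dimension in the comparison
  of the two norms by \<open>card S\<close>.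
\<close>
lemma l1_norm_restrict_le:
  fixes x :: "real ^ 'm"
  shows "l1_norm (restrict_vec S x) \<le> sqrt (real (card S)) * norm x"
proof -
  have "l1_norm (restrict_vec S x) = (\<Sum>i\<in>S. \<bar>x $ i\<bar>)"
    by (simp add: l1_norm_def restrict_vec_def if_distrib sum.If_cases cong: if_cong)
  also have "\<dots> \<le> L2_set (\<lambda>_. 1) S * L2_set (\<lambda>i. x $ i) S"
    using L2_set_mult_ineq[of "\<lambda>_. 1" "\<lambda>i. x $ i" S] by simp
  also have "L2_set (\<lambda>i. x $ i) S \<le> L2_set (\<lambda>i. x $ i) UNIV"
    unfolding L2_set_def by (intro real_sqrt_le_mono sum_mono2) auto
  also have "L2_set (\<lambda>_. 1) S * L2_set (\<lambda>i. x $ i) UNIV = sqrt (real (card S)) * norm x"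
    by (simp add: L2_set_def norm_vec_def)
  finally show ?thesis
    by (simp add: mult_left_mono L2_set_nonneg)
qed

text \<open>Hoelder's inequality for the exponents 1 and \<open>\<infinity>\<close>; it controls the noise term.\<close>
lemma inner_le_l1_norm_infnorm:
  fixes x z :: "real ^ 'm"
  shows "x \<bullet> z \<le> l1_norm x * infnorm z"
proof -
  have "x \<bullet> z \<le> (\<Sum>i\<in>UNIV. \<bar>x $ i\<bar> * infnorm z)"
    unfolding inner_vec_def
  proof (rule sum_mono)
    fix i
    have "x $ i * z $ i \<le> \<bar>x $ i\<bar> * \<bar>z $ i\<bar>"
      by (metis abs_ge_self abs_mult)
    also have "\<dots> \<le> \<bar>x $ i\<bar> * infnorm z"
      by (intro mult_left_mono component_le_infnorm_cart) simp
    finally show "x $ i \<bullet> z $ i \<le> \<bar>x $ i\<bar> * infnorm z" by simp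
  qed
  then show ?thesis by (simp add: l1_norm_def sum_distrib_right)
qed

text \<open>
  Moving from \<open>b\<close> to \<open>b + h\<close> can lower the \<open>\<ell>\<^sub>1\<close> norm only through the entries of \<open>h\<close> in \<open>S\<close> and
  through cancellation with the tail of \<open>b\<close> outside \<open>S\<close>; the other entries of \<open>h\<close> raise it.
\<close>
lemma l1_norm_decrease:
  fixes b h :: "real ^ 'm"
  shows "l1_norm b - l1_norm (b + h) \<le>
    2 * l1_norm (restrict_vec S h) - l1_norm h + 2 * l1_norm (restrict_vec (- S) b)"
  unfolding l1_norm_def sum_distrib_left sum_subtractf[symmetric] sum.distrib[symmetric]
  by (intro sum_mono) (auto simp: restrict_vec_def)

section \<open>The prediction error of the lasso\<close>

\<comment> \<open>Adjoints stay visible as products with \<open>transpose A\<close> instead of becoming row vector products.\<close>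
declare transpose_matrix_vector [simp del]

lemma inner_matrix_transpose:
  fixes A :: "real ^ 'p ^ 'n"
  shows "(A *v x) \<bullet> z = x \<bullet> (transpose A *v z)"
  by (metis dot_lmul_matrix inner_commute transpose_matrix_vector)

text \<open>
  The residual of \<open>\<beta>l\<close> is \<open>X *v h - \<epsilon>\<close> and that of \<open>\<beta>s\<close> is \<open>- \<epsilon>\<close>, so that \<open>norm \<epsilon>\<close> cancels when
  the two objective values are compared.
\<close>
lemma lasso_basic_inequality:
  fixes X :: "real ^ 'p ^ 'n"
  assumes "lasso_estimator X (X *v \<beta>s + \<epsilon>) l \<beta>l"
    and "infnorm (transpose X *v \<epsilon>) \<le> l0"
  shows "(norm (X *v (\<beta>l - \<beta>s)))\<^sup>2 / 2 \<le>
    l0 * l1_norm (\<beta>l - \<beta>s) + l * (l1_norm \<beta>s - l1_norm \<beta>l)"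
proof -
  let ?h = "\<beta>l - \<beta>s"
  have residual: "X *v \<beta>l - (X *v \<beta>s + \<epsilon>) = X *v ?h - \<epsilon>"
    by (simp add: matrix_vector_mult_diff_distrib)
  have "1 / 2 * (norm (X *v \<beta>l - (X *v \<beta>s + \<epsilon>)))\<^sup>2 + l * l1_norm \<beta>l \<le>
      1 / 2 * (norm (X *v \<beta>s - (X *v \<beta>s + \<epsilon>)))\<^sup>2 + l * l1_norm \<beta>s"
    using assms(1) unfolding lasso_estimator_def is_arg_min_linorder by blast
  then have "1 / 2 * (norm (X *v ?h - \<epsilon>))\<^sup>2 + l * l1_norm \<beta>l \<le>
      1 / 2 * (norm \<epsilon>)\<^sup>2 + l * l1_norm \<beta>s"
    unfolding residual by simp
  moreover have "(norm (X *v ?h - \<epsilon>))\<^sup>2 = (norm (X *v ?h))\<^sup>2 - 2 * ((X *v ?h) \<bullet> \<epsilon>) + (norm \<epsilon>)\<^sup>2"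
    by (simp add: power2_norm_eq_inner inner_diff inner_commute algebra_simps)
  moreover have "(X *v ?h) \<bullet> \<epsilon> \<le> l0 * l1_norm ?h"
  proof -
    have "(X *v ?h) \<bullet> \<epsilon> = ?h \<bullet> (transpose X *v \<epsilon>)"
      by (rule inner_matrix_transpose)
    also have "\<dots> \<le> l1_norm ?h * infnorm (transpose X *v \<epsilon>)"
      by (rule inner_le_l1_norm_infnorm)
    also have "\<dots> \<le> l1_norm ?h * l0"
      using assms(2) by (intro mult_left_mono l1_norm_nonneg)
    finally show ?thesis by (simp add: mult.commute)
  qed
  ultimately show ?thesis by (simp add: algebra_simps)
qed

text \<open>
  Were \<open>N > 4 * l * a + b / a\<close>, then \<open>N - 4 * l * a > b / a\<close> and \<open>N > 4 * l * a\<close>, and multiplying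
  would give \<open>N * (N - 4 * l * a) > 4 * l * b\<close>.
\<close>
lemma quadratic_inequality_bound:
  fixes N l a b :: real
  assumes "N\<^sup>2 \<le> 4 * l * a * N + 4 * l * b" and "0 < l" "0 < a" "0 \<le> b"
  shows "N \<le> 4 * l * a + b / a"
proof (rule ccontr)
  assume "\<not> ?thesis"
  then have *: "b / a < N - 4 * l * a" by simp
  have "0 \<le> b / a" and la: "0 < 4 * l * a" using assms by simp_all
  with * have N: "4 * l * a < N" by simp
  have "4 * l * b = 4 * l * a * (b / a)" using assms by simp
  also have "\<dots> < 4 * l * a * (N - 4 * l * a)"
    using * la by (intro mult_strict_left_mono)
  also have "\<dots> \<le> N * (N - 4 * l * a)"
    using N by (intro mult_right_mono) auto
  finally show False
    using assms(1) by (simp add: power2_eq_square algebra_simps)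
qed

text \<open>
  The distortion inequality is needed only for the error vector \<open>\<beta>l - \<beta>s\<close> and one set \<open>S\<close>. The
  threshold \<open>l0 / (1 - 2 * \<kappa>)\<close> for \<open>l\<close> is exactly where the \<open>\<ell>\<^sub>1\<close> norm of the error gets a
  nonpositive coefficient and can be dropped.
\<close>
lemma lasso_prediction_error:
  fixes X :: "real ^ 'p ^ 'n"
  assumes lasso: "lasso_estimator X (X *v \<beta>s + \<epsilon>) l \<beta>l"
    and noise: "infnorm (transpose X *v \<epsilon>) \<le> l0"
    and "0 < l" "\<kappa> < 1 / 2" "l0 / (1 - 2 * \<kappa>) < l" "0 < a"
    and dist: "l1_norm (restrict_vec S (\<beta>l - \<beta>s)) \<le>
      a * norm (X *v (\<beta>l - \<beta>s)) + \<kappa> * l1_norm (\<beta>l - \<beta>s)"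
  shows "norm (X *v (\<beta>l - \<beta>s)) \<le> 4 * l * a + l1_norm (restrict_vec (- S) \<beta>s) / a"
proof -
  let ?h = "\<beta>l - \<beta>s" and ?b = "l1_norm (restrict_vec (- S) \<beta>s)"
  let ?N = "norm (X *v ?h)"
  have "?N\<^sup>2 / 2 \<le> l0 * l1_norm ?h + l * (l1_norm \<beta>s - l1_norm \<beta>l)"
    using lasso noise by (rule lasso_basic_inequality)
  also have "l1_norm \<beta>s - l1_norm \<beta>l \<le>
      2 * l1_norm (restrict_vec S ?h) - l1_norm ?h + 2 * ?b"
    using l1_norm_decrease[of \<beta>s ?h S] by simp
  also have "\<dots> \<le> 2 * (a * ?N + \<kappa> * l1_norm ?h) - l1_norm ?h + 2 * ?b"
    using dist by simp
  finally have "?N\<^sup>2 / 2 \<le>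
      l0 * l1_norm ?h + l * (2 * (a * ?N + \<kappa> * l1_norm ?h) - l1_norm ?h + 2 * ?b)"
    using \<open>0 < l\<close> by (simp add: mult_left_mono)
  moreover have "(l0 - l * (1 - 2 * \<kappa>)) * l1_norm ?h \<le> 0"
    using assms(4,5) l1_norm_nonneg
    by (intro mult_nonpos_nonneg) (auto simp: divide_less_eq)
  ultimately have "?N\<^sup>2 \<le> 4 * l * a * ?N + 4 * l * ?b"
    by (simp add: algebra_simps)
  then show ?thesis
    using assms by (intro quadratic_inequality_bound l1_norm_nonneg)
qed

section \<open>The smallest singular value\<close>

text \<open>
  The left singular vectors are eigenvectors of the symmetric matrix \<open>X ** transpose X\<close> for the
  squared singular values, hence orthogonal for different singular values; a Euclidean space
  contains only finitely many nonzero pairwise orthogonal vectors.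
\<close>
lemma finite_singular_values:
  fixes X :: "real ^ 'p ^ 'n"
  shows "finite (singular_values X)"
proof -
  have "\<forall>\<sigma>\<in>singular_values X. \<exists>u. norm u = 1 \<and> X *v (transpose X *v u) = \<sigma>\<^sup>2 *\<^sub>R u"
    by (auto simp: singular_values_def matrix_vector_mult_scaleR power2_eq_square)
  then obtain u where norm_u: "\<And>\<sigma>. \<sigma> \<in> singular_values X \<Longrightarrow> norm (u \<sigma>) = 1"
    and eigen: "\<And>\<sigma>. \<sigma> \<in> singular_values X \<Longrightarrow> X *v (transpose X *v u \<sigma>) = \<sigma>\<^sup>2 *\<^sub>R u \<sigma>"
    by metis
  have orth: "u \<sigma> \<bullet> u \<tau> = 0"
    if "\<sigma> \<in> singular_values X" "\<tau> \<in> singular_values X" "\<sigma> \<noteq> \<tau>" for \<sigma> \<tau>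
  proof -
    have "(X *v (transpose X *v u \<sigma>)) \<bullet> u \<tau> = u \<sigma> \<bullet> (X *v (transpose X *v u \<tau>))"
      by (simp add: inner_matrix_transpose)
    then have "\<sigma>\<^sup>2 * (u \<sigma> \<bullet> u \<tau>) = \<tau>\<^sup>2 * (u \<sigma> \<bullet> u \<tau>)"
      using that by (simp add: eigen)
    moreover have "\<sigma>\<^sup>2 \<noteq> \<tau>\<^sup>2"
      using that by (simp add: singular_values_def power2_eq_iff_nonneg)
    ultimately show ?thesis by simp
  qed
  have "pairwise orthogonal (u ` singular_values X)"
    by (auto simp: pairwise_def orthogonal_def intro!: orth)
  moreover have "0 \<notin> u ` singular_values X"
    using norm_u by fastforce
  ultimately have "finite (u ` singular_values X)"
    using pairwise_orthogonal_independent independent_imp_finite by blast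
  moreover have "inj_on u (singular_values X)"
    using orth norm_u by (intro inj_onI) (metis norm_eq_zero inner_eq_zero_iff zero_neq_one)
  ultimately show ?thesis
    by (simp add: finite_image_iff)
qed

text \<open>
  The quadratic form \<open>w \<mapsto> (norm (A *v w))\<^sup>2 - \<sigma>\<^sup>2 * (norm w)\<^sup>2\<close> is nonnegative and vanishes at
  \<open>u\<close>, so that \<open>u\<close> minimises it. Its gradient at \<open>u\<close> is therefore
  zero, and that gradient is twice the difference of the two sides of the eigenvalue equation.
\<close>
lemma minimiser_is_eigenvector:
  fixes A :: "real ^ 'n ^ 'p"
  assumes min: "\<And>w. \<sigma> * norm w \<le> norm (A *v w)" and "0 \<le> \<sigma>"
    and attained: "norm (A *v u) = \<sigma> * norm u"
  shows "transpose A *v (A *v u) = \<sigma>\<^sup>2 *\<^sub>R u"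
proof -
  define g where "g = transpose A *v (A *v u) - \<sigma>\<^sup>2 *\<^sub>R u"
  define q where "q w = (norm (A *v w))\<^sup>2 - \<sigma>\<^sup>2 * (norm w)\<^sup>2" for w
  have q_nonneg: "0 \<le> q w" for w
    using power_mono[OF min, of w 2] \<open>0 \<le> \<sigma>\<close> by (simp add: q_def power_mult_distrib)
  have "q u = 0"
    by (simp add: q_def attained power_mult_distrib)
  have cross: "g \<bullet> g = (A *v u) \<bullet> (A *v g) - \<sigma>\<^sup>2 * (u \<bullet> g)"
  proof -
    have "g \<bullet> g = (transpose A *v (A *v u)) \<bullet> g - \<sigma>\<^sup>2 * (u \<bullet> g)"
      by (subst g_def) (simp add: inner_diff_left)
    then show ?thesis
      by (simp add: inner_matrix_transpose)
  qed
  have q_line: "q (u - t *\<^sub>R g) = t\<^sup>2 * q g - 2 * t * (g \<bullet> g)" for t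
  proof -
    have "q (u - t *\<^sub>R g) = q u - 2 * t * ((A *v u) \<bullet> (A *v g) - \<sigma>\<^sup>2 * (u \<bullet> g)) + t\<^sup>2 * q g"
      unfolding q_def power2_norm_eq_inner matrix_vector_mult_diff_distrib
        matrix_vector_mult_scaleR inner_diff
      by (simp add: inner_commute power2_eq_square algebra_simps del: dot_square_norm)
    then show ?thesis using \<open>q u = 0\<close> cross by simp
  qed
  have "g \<bullet> g \<le> 0"
  proof (rule ccontr)
    assume "\<not> ?thesis"
    then have pos: "0 < g \<bullet> g" by (simp only: not_le)
    \<comment> \<open>A step so short that the linear decrease outweighs the quadratic term; the summand 1 only
      keeps the denominator positive.\<close>
    define t where "t = (g \<bullet> g) / (q g + 1)"
    have "0 < t" using pos q_nonneg[of g] by (simp add: t_def)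
    have "t * q g \<le> t * (q g + 1)" using \<open>0 < t\<close> by simp
    also have "\<dots> = g \<bullet> g" using q_nonneg[of g] by (simp add: t_def)
    also have "\<dots> < 2 * (g \<bullet> g)" using pos by linarith
    finally have "t * (t * q g) < t * (2 * (g \<bullet> g))"
      using \<open>0 < t\<close> by (rule mult_strict_left_mono)
    then have "q (u - t *\<^sub>R g) < 0"
      by (simp add: q_line power2_eq_square algebra_simps)
    with q_nonneg show False by (simp add: not_less[symmetric])
  qed
  then have "g = 0" by (metis inner_ge_zero inner_eq_zero_iff order_antisym)
  then show ?thesis by (simp add: g_def)
qed

text \<open>
  Full row rank makes \<open>transpose X\<close> injective, so that the minimum of \<open>norm (transpose X *v u)\<close>
  over the compact unit sphere is positive. The minimiser is a left singular vector, and no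
  singular value is below the minimum because \<open>transpose X\<close> maps some unit vector to a vector whose
  norm is that singular value.
\<close>
lemma smallest_singular_value_full_rank:
  fixes X :: "real ^ 'p ^ 'n"
  assumes "rank X = CARD('n)"
  shows smallest_singular_value_pos: "0 < smallest_singular_value X"
    and smallest_singular_value_le:
      "smallest_singular_value X * norm w \<le> norm (transpose X *v w)"
proof -
  let ?f = "\<lambda>u. norm (transpose X *v u)"
  have "compact (sphere 0 1 :: (real ^ 'n) set)" "sphere 0 1 \<noteq> ({} :: (real ^ 'n) set)"
    by simp_all
  moreover have "continuous_on (sphere 0 1) ?f"
    by (intro continuous_on_norm linear_continuous_on matrix_vector_mul_bounded_linear)
  ultimately obtain u where u: "norm u = 1" and u_min: "\<And>w. norm w = 1 \<Longrightarrow> ?f u \<le> ?f w"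
    using continuous_attains_inf[of "sphere 0 1" ?f] by (auto simp: dist_norm)
  define \<sigma> where "\<sigma> = ?f u"
  have "inj ((*v) (transpose X))"
    using assms by (simp flip: full_rank_injective add: rank_transpose)
  then have "transpose X *v u \<noteq> 0"
    using u by (metis injD matrix_vector_mult_0_right norm_zero zero_neq_one)
  then have "0 < \<sigma>" by (simp add: \<sigma>_def)
  have le: "\<sigma> * norm w \<le> ?f w" for w
  proof (cases "w = 0")
    case False
    then have "\<sigma> \<le> ?f (w /\<^sub>R norm w)"
      unfolding \<sigma>_def by (intro u_min) simp
    also have "\<dots> = ?f w / norm w"
      by (simp add: matrix_vector_mult_scaleR divide_inverse mult.commute)
    finally show ?thesis using False by (simp add: field_simps)
  qed simp
  have "X *v (transpose X *v u) = \<sigma>\<^sup>2 *\<^sub>R u"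
  proof -
    have "0 \<le> \<sigma>" "norm (transpose X *v u) = \<sigma> * norm u"
      by (simp_all add: \<sigma>_def u)
    from minimiser_is_eigenvector[OF le this] show ?thesis by simp
  qed
  then have "X *v ((transpose X *v u) /\<^sub>R \<sigma>) = \<sigma> *\<^sub>R u"
    using \<open>0 < \<sigma>\<close> by (simp add: matrix_vector_mult_scaleR power2_eq_square)
  moreover have "transpose X *v u = \<sigma> *\<^sub>R ((transpose X *v u) /\<^sub>R \<sigma>)"
    using \<open>0 < \<sigma>\<close> by simp
  moreover have "norm ((transpose X *v u) /\<^sub>R \<sigma>) = 1"
    using \<open>0 < \<sigma>\<close> by (simp add: \<sigma>_def)
  ultimately have "\<sigma> \<in> singular_values X"
    unfolding singular_values_def using u \<open>0 < \<sigma>\<close> less_imp_le by blast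
  moreover have "\<sigma> \<le> \<tau>" if \<tau>: "\<tau> \<in> singular_values X" for \<tau>
  proof -
    obtain u' v' where "0 \<le> \<tau>" "norm u' = 1" "norm v' = 1" "transpose X *v u' = \<tau> *\<^sub>R v'"
      using \<tau> by (auto simp: singular_values_def)
    with le[of u'] show ?thesis by simp
  qed
  ultimately have "smallest_singular_value X = \<sigma>"
    unfolding smallest_singular_value_def by (intro Min_eqI finite_singular_values)
  with \<open>0 < \<sigma>\<close> le show "0 < smallest_singular_value X"
    "smallest_singular_value X * norm w \<le> norm (transpose X *v w)" by simp_all
qed

text \<open>
  The minimum-norm solution of \<open>X *v r = X *v \<gamma>\<close> has the form \<open>r = transpose X *v w\<close>, and
  then \<open>(norm r)\<^sup>2 = (X *v r) \<bullet> w \<le> norm (X *v \<gamma>) * norm w\<close> with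
  \<open>norm w \<le> norm r / smallest_singular_value X\<close>.
\<close>
lemma kernel_decomposition:
  fixes X :: "real ^ 'p ^ 'n"
  assumes "rank X = CARD('n)"
  obtains k r where "\<gamma> = k + r" "k \<in> matrix_kernel X"
    "smallest_singular_value X * norm r \<le> norm (X *v \<gamma>)"
proof -
  let ?\<rho> = "smallest_singular_value X"
  have \<rho>: "0 < ?\<rho>" "\<And>w. ?\<rho> * norm w \<le> norm (transpose X *v w)"
    using smallest_singular_value_full_rank[OF assms] by auto
  let ?G = "X ** transpose X"
  have "w = 0" if "?G *v w = 0" for w
  proof -
    have "(norm (transpose X *v w))\<^sup>2 = (?G *v w) \<bullet> w"
      unfolding power2_norm_eq_inner matrix_vector_mul_assoc[symmetric]
      by (rule inner_matrix_transpose[symmetric])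
    with that \<rho>(2)[of w] have "?\<rho> * norm w \<le> 0" by simp
    with \<rho>(1) show "w = 0" by (simp add: mult_le_0_iff)
  qed
  then have "inj ((*v) ?G)"
    by (simp add: linear_injective_0)
  then have "surj ((*v) ?G)"
    by (intro linear_injective_imp_surjective) simp_all
  then obtain w where "?G *v w = X *v \<gamma>"
    by (metis surjD)
  define r where "r = transpose X *v w"
  have Xr: "X *v r = X *v \<gamma>"
    using \<open>?G *v w = X *v \<gamma>\<close> by (simp add: r_def matrix_vector_mul_assoc)
  have "(X *v r) \<bullet> w = (norm r)\<^sup>2"
    unfolding r_def power2_norm_eq_inner by (rule inner_matrix_transpose)
  then have "?\<rho> * norm r * norm r = ?\<rho> * ((X *v r) \<bullet> w)"
    by (simp add: power2_eq_square)
  also have "\<dots> \<le> ?\<rho> * (norm (X *v r) * norm w)"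
    using \<rho>(1) by (intro mult_left_mono norm_cauchy_schwarz) simp
  also have "\<dots> = norm (X *v r) * (?\<rho> * norm w)" by simp
  also have "\<dots> \<le> norm (X *v r) * norm r"
    unfolding r_def by (intro mult_left_mono \<rho>(2)) simp
  finally have "?\<rho> * norm r \<le> norm (X *v \<gamma>)"
    unfolding Xr by (cases "r = 0") (simp_all add: mult_le_cancel_right)
  moreover have "\<gamma> - r \<in> matrix_kernel X"
    by (simp add: matrix_kernel_def matrix_vector_mult_diff_distrib Xr)
  ultimately show ?thesis
    using that[of "\<gamma> - r" r] by simp
qed

section \<open>From the distortion of the kernel to the distortion property\<close>

text \<open>
  With \<open>\<gamma> = k + r\<close> as above and \<open>s = card S\<close>, the part \<open>k\<close> contributes at most
  \<open>sqrt s * norm k \<le> sqrt s * \<delta> / sqrt p * l1_norm k\<close>, where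
  \<open>l1_norm k \<le> l1_norm \<gamma> + sqrt p * norm r\<close>. The factor \<open>sqrt s * \<delta> / sqrt p\<close> must be bounded by
  \<open>\<kappa>\<close> only in front of \<open>l1_norm \<gamma>\<close>: in front of \<open>norm r\<close> the factor \<open>sqrt p\<close> cancels exactly,
  leaving \<open>(1 + \<delta>) * sqrt s * norm r\<close> in total,
  which is at most \<open>2 * \<delta> * sqrt s * norm r\<close> because \<open>1 \<le> \<delta>\<close>.
\<close>
lemma distortion_imp_UDP:
  fixes X :: "real ^ 'p ^ 'n"
  assumes "rank X = CARD('n)" and "0 < \<kappa>"
    and dist: "has_distortion (matrix_kernel X) \<delta>"
  shows "UDP X ((\<kappa> / \<delta>)\<^sup>2 * real CARD('p)) \<kappa> (2 * \<delta> / smallest_singular_value X)"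
  unfolding UDP_def
proof (intro allI impI)
  fix \<gamma> :: "real ^ 'p" and s :: nat and S :: "'p set"
  assume S: "1 \<le> s \<and> real s \<le> (\<kappa> / \<delta>)\<^sup>2 * real CARD('p) \<and> card S = s"
  let ?\<rho> = "smallest_singular_value X" and ?p = "real CARD('p)" and ?s = "sqrt (real s)"
  have "0 < ?\<rho>" using assms(1) by (rule smallest_singular_value_pos)
  have "1 \<le> \<delta>" using dist by (simp add: has_distortion_def)
  have "0 < sqrt ?p" by simp
  obtain k r where \<gamma>: "\<gamma> = k + r" and k: "k \<in> matrix_kernel X"
    and r: "?\<rho> * norm r \<le> norm (X *v \<gamma>)"
    using kernel_decomposition[OF assms(1)] .
  define c where "c = ?s * \<delta> / sqrt ?p"
  have "0 \<le> c" using \<open>1 \<le> \<delta>\<close> by (simp add: c_def)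
  have "?s \<le> sqrt ((\<kappa> / \<delta>)\<^sup>2 * ?p)" using S by simp
  also have "\<dots> = \<kappa> / \<delta> * sqrt ?p"
    using \<open>0 < \<kappa>\<close> \<open>1 \<le> \<delta>\<close> by (simp add: real_sqrt_mult)
  finally have "c \<le> \<kappa>"
    using \<open>1 \<le> \<delta>\<close> \<open>0 < sqrt ?p\<close> by (simp add: c_def field_simps)
  have norm_k: "norm k \<le> \<delta> / sqrt ?p * l1_norm k"
    using dist k \<open>0 < sqrt ?p\<close> by (simp add: has_distortion_def field_simps)
  have l1_k: "l1_norm k \<le> l1_norm \<gamma> + sqrt ?p * norm r"
    using l1_norm_diff_triangle[of \<gamma> r] l1_norm_le[of r] by (simp add: \<gamma>)
  have "l1_norm (restrict_vec S k) \<le> ?s * norm k"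
    using l1_norm_restrict_le[of S k] S by simp
  also have "\<dots> \<le> ?s * (\<delta> / sqrt ?p * l1_norm k)"
    using norm_k by (intro mult_left_mono) simp_all
  also have "\<dots> = c * l1_norm k" by (simp add: c_def)
  also have "\<dots> \<le> c * (l1_norm \<gamma> + sqrt ?p * norm r)"
    using l1_k \<open>0 \<le> c\<close> by (rule mult_left_mono)
  also have "\<dots> = c * l1_norm \<gamma> + \<delta> * ?s * norm r"
    using \<open>0 < sqrt ?p\<close> by (simp add: c_def field_simps)
  also have "c * l1_norm \<gamma> \<le> \<kappa> * l1_norm \<gamma>"
    using \<open>c \<le> \<kappa>\<close> l1_norm_nonneg by (rule mult_right_mono)
  finally have k_part: "l1_norm (restrict_vec S k) \<le> \<kappa> * l1_norm \<gamma> + \<delta> * ?s * norm r"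
    by simp
  have "l1_norm (restrict_vec S r) \<le> 1 * (?s * norm r)"
    using l1_norm_restrict_le[of S r] S by simp
  also have "\<dots> \<le> \<delta> * (?s * norm r)"
    using \<open>1 \<le> \<delta>\<close> by (intro mult_right_mono) simp_all
  finally have r_part: "l1_norm (restrict_vec S r) \<le> \<delta> * ?s * norm r" by simp
  have "norm r \<le> norm (X *v \<gamma>) / ?\<rho>"
    using r \<open>0 < ?\<rho>\<close> by (simp add: field_simps)
  then have "2 * \<delta> * ?s * norm r \<le> 2 * \<delta> * ?s * (norm (X *v \<gamma>) / ?\<rho>)"
    using \<open>1 \<le> \<delta>\<close> by (intro mult_left_mono) simp_all
  moreover have "l1_norm (restrict_vec S \<gamma>) \<le>
      l1_norm (restrict_vec S k) + l1_norm (restrict_vec S r)"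
    unfolding \<gamma> restrict_vec_add by (rule l1_norm_triangle)
  ultimately show "l1_norm (restrict_vec S \<gamma>) \<le>
      2 * \<delta> / ?\<rho> * ?s * norm (X *v \<gamma>) + \<kappa> * l1_norm \<gamma>"
    using k_part r_part by simp
qed

section \<open>The lasso under the distortion property\<close>

lemma lasso_prediction_error_UDP:
  fixes X :: "real ^ 'p ^ 'n"
  assumes "lasso_estimator X (X *v \<beta>s + \<epsilon>) l \<beta>l"
    and "infnorm (transpose X *v \<epsilon>) \<le> l0"
    and "0 < l" "\<kappa> < 1 / 2" "l0 / (1 - 2 * \<kappa>) < l" "0 < \<Delta>"
    and "UDP X S0 \<kappa> \<Delta>" "1 \<le> card S" "real (card S) \<le> S0"
  shows "norm (X *v \<beta>l - X *v \<beta>s) \<le> 4 * l * \<Delta> * sqrt (real (card S)) +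
    l1_norm (restrict_vec (- S) \<beta>s) / (\<Delta> * sqrt (real (card S)))"
proof -
  have "0 < \<Delta> * sqrt (real (card S))"
    using assms by simp
  moreover have "l1_norm (restrict_vec S (\<beta>l - \<beta>s)) \<le>
      \<Delta> * sqrt (real (card S)) * norm (X *v (\<beta>l - \<beta>s)) + \<kappa> * l1_norm (\<beta>l - \<beta>s)"
    using assms(7-9) unfolding UDP_def by blast
  ultimately show ?thesis
    using lasso_prediction_error[OF assms(1-5), of "\<Delta> * sqrt (real (card S))" S]
    by (simp add: matrix_vector_mult_diff_distrib mult.assoc)
qed

theorem theorem2p2:
  fixes X :: "real ^ 'p ^ 'n"
    and \<beta>s :: "real ^ 'p"
    and \<epsilon> y :: "real ^ 'n"
    and l0 :: real
  assumes "CARD('n) \<le> CARD('p)"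
    and "rank X = CARD('n)"
    and "y = X *v \<beta>s + \<epsilon>"
    and "infnorm (transpose X *v \<epsilon>) \<le> l0"
  shows
    "(\<forall>(S0::real) (\<kappa>::real) (\<Delta>::real) (l::real) \<beta>l.
        1 \<le> S0 \<and> S0 \<le> real CARD('p) \<and> 0 < \<kappa> \<and> \<kappa> < 1 / 2 \<and> 0 < \<Delta> \<and> UDP X S0 \<kappa> \<Delta> \<and>
        0 < l \<and> l0 / (1 - 2 * \<kappa>) < l \<and> lasso_estimator X y l \<beta>l \<longrightarrow>
        norm (X *v \<beta>l - X *v \<beta>s) \<le>
          Min ((\<lambda>S. 4 * l * \<Delta> * sqrt (real (card S)) +
                     l1_norm (restrict_vec (- S) \<beta>s) / (\<Delta> * sqrt (real (card S)))) `
               {S. 1 \<le> card S \<and> real (card S) \<le> S0}))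
     \<and>
     (let \<rho> = smallest_singular_value X; \<delta> = distortion (matrix_kernel X) in
      \<forall>(\<kappa>::real) (l::real) \<beta>l S.
        0 < \<kappa> \<and> \<kappa> < 1 / 2 \<and>
        0 < l \<and> l0 / (1 - 2 * \<kappa>) < l \<and> lasso_estimator X y l \<beta>l \<and>
        1 \<le> card S \<and> real (card S) \<le> (\<kappa> / \<delta>)\<^sup>2 * real CARD('p) \<longrightarrow>
        norm (X *v \<beta>l - X *v \<beta>s) \<le>
          4 * l * (2 * \<delta> / \<rho>) * sqrt (real (card S)) +
          1 / (2 * \<delta> * sqrt (real (card S))) * \<rho> * l1_norm (restrict_vec (- S) \<beta>s))"
proof -
  have bound: "norm (X *v \<beta>l - X *v \<beta>s) \<le> 4 * l * \<Delta> * sqrt (real (card S)) +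
      l1_norm (restrict_vec (- S) \<beta>s) / (\<Delta> * sqrt (real (card S)))"
    if "lasso_estimator X y l \<beta>l" "0 < l" "\<kappa> < 1 / 2" "l0 / (1 - 2 * \<kappa>) < l" "0 < \<Delta>"
      "UDP X S0 \<kappa> \<Delta>" "1 \<le> card S" "real (card S) \<le> S0" for S0 \<kappa> \<Delta> l \<beta>l S
    using lasso_prediction_error_UDP[OF that(1)[unfolded assms(3)] assms(4) that(2-)] .
  have "norm (X *v \<beta>l - X *v \<beta>s) \<le>
      Min ((\<lambda>S. 4 * l * \<Delta> * sqrt (real (card S)) +
                 l1_norm (restrict_vec (- S) \<beta>s) / (\<Delta> * sqrt (real (card S)))) `
           {S. 1 \<le> card S \<and> real (card S) \<le> S0})"
    if "1 \<le> S0" "\<kappa> < 1 / 2" "0 < \<Delta>" "UDP X S0 \<kappa> \<Delta>" "0 < l" "l0 / (1 - 2 * \<kappa>) < l"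
      "lasso_estimator X y l \<beta>l" for S0 \<kappa> \<Delta> l \<beta>l
  proof (rule Min.boundedI)
    have "{undefined} \<in> {S :: 'p set. 1 \<le> card S \<and> real (card S) \<le> S0}"
      using that(1) by simp
    then show "(\<lambda>S. 4 * l * \<Delta> * sqrt (real (card S)) +
        l1_norm (restrict_vec (- S) \<beta>s) / (\<Delta> * sqrt (real (card S)))) `
        {S. 1 \<le> card S \<and> real (card S) \<le> S0} \<noteq> {}"
      by blast
  qed (use that bound in auto)
  moreover
  define \<rho> where "\<rho> = smallest_singular_value X"
  define \<delta> where "\<delta> = distortion (matrix_kernel X)"
  have \<delta>: "has_distortion (matrix_kernel X) \<delta>"
    unfolding \<delta>_def by (rule is_least_distortion)
  have pos: "0 < 2 * \<delta> / \<rho>"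
    using \<delta> smallest_singular_value_pos[OF assms(2)] by (simp add: has_distortion_def \<rho>_def)
  have "norm (X *v \<beta>l - X *v \<beta>s) \<le>
      4 * l * (2 * \<delta> / \<rho>) * sqrt (real (card S)) +
      1 / (2 * \<delta> * sqrt (real (card S))) * \<rho> * l1_norm (restrict_vec (- S) \<beta>s)"
    if "0 < \<kappa>" "\<kappa> < 1 / 2" "0 < l" "l0 / (1 - 2 * \<kappa>) < l" "lasso_estimator X y l \<beta>l"
      "1 \<le> card S" "real (card S) \<le> (\<kappa> / \<delta>)\<^sup>2 * real CARD('p)" for \<kappa> l \<beta>l S
    using bound[OF that(5,3,2,4) pos _ that(6,7)]
      distortion_imp_UDP[OF assms(2) that(1) \<delta>] by (simp add: \<rho>_def ac_simps)
  ultimately show ?thesis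
    unfolding Let_def \<rho>_def \<delta>_def by blast
qed

end
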